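(* Let $\prec$ be a graded order, let $\boldsymbol{z}_1,\dots,\boldsymbol{z}_m\in\mathbb{F}^n$ be mutually distinct nodes, and for each $i=1,\dots,m$ let $P_{i1},\dots,P_{is_i}\in\mathbb{F}[\boldsymbol{x}]$ be linearly independent polynomials. Consider the multi-node Birkhoff interpolation conditions $$\Delta=\operatorname{span}\{\delta_{\boldsymbol{z}_i}\circ P_{ij}(D) : 1\le i\le m,\ 1\le j\le s_i\}.$$ Put $\tilde{P}_{ij}(\boldsymbol{x})=e^{\boldsymbol{x}\cdot\boldsymbol{z}_i}P_{ij}(\boldsymbol{x})\in\mathbb{F}[[\boldsymbol{x}]]$, and let $$\mathcal{R}=\{R_{ij}(\boldsymbol{x}) : 1\le i\le m,\ 1\le j\le s_i\}\subset\mathbb{F}[[\boldsymbol{x}]]$$ be the reverse reduced set, with respect to $\prec$, of the family $\{\tilde{P}_{ij}(\boldsymbol{x}) : 1\le i\le m,\ 1\le j\le s_i\}$. Then the set of least monomials $$\{\operatorname{lm}(R_{ij}(\boldsymbol{x})) : 1\le i\le m,\ 1\le j\le s_i\}$$ constitutes the minimal monomial basis for $\Delta$ with respect to $\prec$.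
   Context: $\mathbb{F}$ is $\mathbb{R}$ or $\mathbb{C}$, $\mathbb{F}[\boldsymbol{x}]=\mathbb{F}[x_1,\dots,x_n]$, and $\mathbb{F}[[\boldsymbol{x}]]$ is the ring of formal power series in $x_1,\dots,x_n$. For $\boldsymbol{\alpha}\in\mathbb{N}^n$, $D^{\boldsymbol{\alpha}}=\partial^{|\boldsymbol{\alpha}|}/\partial x_1^{\alpha_1}\cdots\partial x_n^{\alpha_n}$; for $P=\sum_{\boldsymbol{\alpha}}e_{\boldsymbol{\alpha}}\boldsymbol{x}^{\boldsymbol{\alpha}}\in\mathbb{F}[\boldsymbol{x}]$, $P(D)=\sum_{\boldsymbol{\alpha}}e_{\boldsymbol{\alpha}}D^{\boldsymbol{\alpha}}$. $\delta_{\boldsymbol{z}}\circ P(D)$ is the functional $f\mapsto(P(D)f)(\boldsymbol{z})$ on $\mathbb{F}[\boldsymbol{x}]$. $e^{\boldsymbol{x}\cdot\boldsymbol{z}}=\sum_{k\ge0}(\boldsymbol{x}\cdot\boldsymbol{z})^k/k!$ with $\boldsymbol{x}\cdot\boldsymbol{z}=\sum_k x_kz_k$. A graded order is a monomial order that compares total degree first. For a nonzero power series $R$, its support $\Lambda\{R\}$ is the set of monomials occurring in $R$ with nonzero coefficient, and $\operatorname{lm}(R)$ is the least element of $\Lambda\{R\}$ with respect to $\prec$. A finite linearly independent family of power series $\{R_k\}$ is a reverse reduced set with respect to $\prec$ if (1) for each $k$ the coefficient of $\operatorname{lm}(R_k)$ in $R_k$ is $1$; (2) for all $k\neq k'$,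 $\operatorname{lm}(R_k)\notin\Lambda\{R_{k'}\}$. The reverse reduced set of a finite linearly independent family is a reverse reduced set with the same number of elements having the same $\mathbb{F}$-linear span as the family (obtained by Gaussian elimination). For linearly independent functionals $L_1,\dots,L_N$ on $\mathbb{F}[\boldsymbol{x}]$ and $\Delta=\operatorname{span}\{L_1,\dots,L_N\}$, a finite set $T$ of monomials with $|T|=N$ is a proper interpolation basis for $\Delta$ if for all $c_1,\dots,c_N\in\mathbb{F}$ there is a unique $p\in\operatorname{span}T$ with $L_i(p)=c_i$ for all $i$. $T$ is a minimal monomial basis for $\Delta$ with respect to $\prec$ if (1) $T$ is a proper interpolation basis for $\Delta$; (2) replacing any monomial in $T$ by a monomial that is lower in the order $\prec$ can never yield another proper interpolation basis for $\Delta$. *)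

theory Defs
  imports
    "HOL-Analysis.Finite_Cartesian_Product"
    "HOL-Library.Poly_Mapping"
    "HOL-Library.Function_Algebras"
begin

text \<open>
  The variables \<open>x\<^sub>1, \<dots>, x\<^sub>n\<close> are indexed by a finite type \<open>'n\<close>.  A monomial is identified with its
  exponent vector, so that \<open>+\<close> on monomials is multiplication.  The scalars range over a
  \<^class>\<open>real_normed_field\<close>; up to isomorphism the only such fields are the real and the complex
  numbers (Gelfand--Mazur).
\<close>

type_synonym 'n monom = "'n \<Rightarrow>\<^sub>0 nat"

type_synonym ('n, 'a) mpoly = "'n monom \<Rightarrow>\<^sub>0 'a"

type_synonym ('n, 'a) mseries = "'n monom \<Rightarrow> 'a"

definition total_degree :: "'n::finite monom \<Rightarrow> nat" where
  "total_degree \<alpha> = (\<Sum>i\<in>UNIV. poly_mapping.lookup \<alpha> i)"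


section \<open>Linear structure\<close>

definition mpoly_scale :: "'a::field \<Rightarrow> ('n, 'a) mpoly \<Rightarrow> ('n, 'a) mpoly" where
  "mpoly_scale c p = Poly_Mapping.map ((*) c) p"

lemma lookup_mpoly_scale [simp]: "poly_mapping.lookup (mpoly_scale c p) \<alpha> = c * poly_mapping.lookup p \<alpha>"
  by (simp add: mpoly_scale_def map.rep_eq when_def)

global_interpretation mpoly: vector_space mpoly_scale
  by unfold_locales (auto intro!: poly_mapping_eqI simp: lookup_add algebra_simps)

text \<open>Pointwise scaling is used both for power series and for functionals on polynomials.\<close>

definition fun_scale :: "'a::field \<Rightarrow> ('x \<Rightarrow> 'a) \<Rightarrow> ('x \<Rightarrow> 'a)" where
  "fun_scale c f = (\<lambda>x. c * f x)"

global_interpretation func: vector_space fun_scale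
  by unfold_locales (auto simp: fun_scale_def fun_eq_iff algebra_simps)

definition (in module) independent_family :: "'i set \<Rightarrow> ('i \<Rightarrow> 'b) \<Rightarrow> bool" where
  "independent_family I f \<longleftrightarrow> inj_on f I \<and> independent (f ` I)"

definition monom_span :: "'n monom set \<Rightarrow> ('n, 'a::field) mpoly set" where
  "monom_span T = mpoly.span ((\<lambda>\<alpha>. Poly_Mapping.single \<alpha> 1) ` T)"


section \<open>Differential operators and Birkhoff functionals\<close>

definition mpoly_eval :: "'a::field ^ 'n \<Rightarrow> ('n::finite, 'a) mpoly \<Rightarrow> 'a" where
  "mpoly_eval z p = (\<Sum>\<alpha>\<in>Poly_Mapping.keys p. poly_mapping.lookup p \<alpha> * (\<Prod>i\<in>UNIV. (z $ i) ^ poly_mapping.lookup \<alpha> i))"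

definition mpoly_pderiv :: "'n \<Rightarrow> ('n, 'a::field) mpoly \<Rightarrow> ('n, 'a) mpoly" where
  "mpoly_pderiv i p =
    (\<Sum>\<alpha>\<in>Poly_Mapping.keys p. Poly_Mapping.single (\<alpha> - Poly_Mapping.single i 1) (of_nat (poly_mapping.lookup \<alpha> i) * poly_mapping.lookup p \<alpha>))"

lemma lookup_mpoly_pderiv:
  fixes i :: 'n and p :: "('n, 'a::field) mpoly"
  shows "poly_mapping.lookup (mpoly_pderiv i p) \<gamma> = of_nat (poly_mapping.lookup \<gamma> i + 1) * poly_mapping.lookup p (\<gamma> + Poly_Mapping.single i 1)"
proof -
  have eq: "(\<alpha> - Poly_Mapping.single i 1 = \<gamma> \<and> poly_mapping.lookup \<alpha> i \<noteq> 0) \<longleftrightarrow> \<alpha> = \<gamma> + Poly_Mapping.single i 1"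
    for \<alpha> :: "'n monom"
  proof
    assume *: "\<alpha> - Poly_Mapping.single i 1 = \<gamma> \<and> poly_mapping.lookup \<alpha> i \<noteq> 0"
    show "\<alpha> = \<gamma> + Poly_Mapping.single i 1"
      by (rule poly_mapping_eqI)
        (use * in \<open>auto simp: lookup_add lookup_minus lookup_single when_def\<close>)
  qed (auto simp: lookup_add)
  have "poly_mapping.lookup (mpoly_pderiv i p) \<gamma> =
    (\<Sum>\<alpha>\<in>Poly_Mapping.keys p. if \<alpha> = \<gamma> + Poly_Mapping.single i 1 then of_nat (poly_mapping.lookup \<alpha> i) * poly_mapping.lookup p \<alpha> else 0)"
    unfolding mpoly_pderiv_def lookup_sum
  proof (rule sum.cong[OF refl])
    fix \<alpha>
    show "poly_mapping.lookup (Poly_Mapping.single (\<alpha> - Poly_Mapping.single i 1) (of_nat (poly_mapping.lookup \<alpha> i) * poly_mapping.lookup p \<alpha>)) \<gamma> =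
      (if \<alpha> = \<gamma> + Poly_Mapping.single i 1 then of_nat (poly_mapping.lookup \<alpha> i) * poly_mapping.lookup p \<alpha> else 0)"
      using eq[of \<alpha>] by (cases "poly_mapping.lookup \<alpha> i = 0") (auto simp: lookup_single when_def)
  qed
  also have "\<dots> = of_nat (poly_mapping.lookup \<gamma> i + 1) * poly_mapping.lookup p (\<gamma> + Poly_Mapping.single i 1)"
    by (auto simp: sum.delta' lookup_add not_in_keys_iff_lookup_eq_zero)
  finally show ?thesis .
qed

text \<open>The operator \<open>D\<^sup>\<alpha>\<close>; the fold does not depend on the order of the variables because the partial
  derivatives commute.\<close>

lemma comp_fun_commute_mpoly_pderiv:
  "comp_fun_commute (mpoly_pderiv :: 'n \<Rightarrow> ('n, 'a::field) mpoly \<Rightarrow> ('n, 'a) mpoly)"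
proof
  fix i j :: 'n
  show "mpoly_pderiv j \<circ> mpoly_pderiv i =
    (mpoly_pderiv i \<circ> mpoly_pderiv j :: ('n, 'a) mpoly \<Rightarrow> ('n, 'a) mpoly)"
    by (intro ext poly_mapping_eqI)
      (auto simp: lookup_mpoly_pderiv lookup_add lookup_single when_def algebra_simps)
qed

definition mpoly_D :: "'n::finite monom \<Rightarrow> ('n, 'a::field) mpoly \<Rightarrow> ('n, 'a) mpoly" where
  "mpoly_D \<alpha> p = Finite_Set.fold (\<lambda>i. mpoly_pderiv i ^^ poly_mapping.lookup \<alpha> i) p UNIV"

lemma comp_fun_commute_mpoly_D:
  "comp_fun_commute (\<lambda>i. mpoly_pderiv i ^^ poly_mapping.lookup \<alpha> i :: ('n, 'a::field) mpoly \<Rightarrow> ('n, 'a) mpoly)"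
  by (rule comp_fun_commute.comp_fun_commute_funpow[OF comp_fun_commute_mpoly_pderiv])

definition mpoly_diffop :: "('n::finite, 'a::field) mpoly \<Rightarrow> ('n, 'a) mpoly \<Rightarrow> ('n, 'a) mpoly" where
  "mpoly_diffop P f = (\<Sum>\<alpha>\<in>Poly_Mapping.keys P. mpoly_scale (poly_mapping.lookup P \<alpha>) (mpoly_D \<alpha> f))"

definition birkhoff_functional ::
    "'a::field ^ 'n \<Rightarrow> ('n::finite, 'a) mpoly \<Rightarrow> ('n, 'a) mpoly \<Rightarrow> 'a" where
  "birkhoff_functional z P = (\<lambda>f. mpoly_eval z (mpoly_diffop P f))"


section \<open>Formal power series\<close>

text \<open>Power series are multiplied by \<open>mseries_mult\<close>, not by the pointwise product of functions.\<close>

lemma finite_monom_decompositions: "finite {(\<alpha>, \<beta>). \<alpha> + \<beta> = (\<gamma> :: 'n::finite monom)}"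
proof (rule finite_subset)
  let ?B = "{f :: 'n \<Rightarrow> nat. \<forall>i. (i \<in> UNIV \<longrightarrow> f i \<in> {..total_degree \<gamma>}) \<and> (i \<notin> UNIV \<longrightarrow> f i = 0)}"
  let ?A = "poly_mapping.lookup -` ?B"
  have "finite ?B"
    by (rule finite_set_of_finite_funs) auto
  then have "finite ?A"
    by (rule finite_vimageI) (auto simp: inj_on_def)
  then show "finite (?A \<times> ?A)" by simp
  have le: "poly_mapping.lookup \<gamma> i \<le> total_degree \<gamma>" for i
    unfolding total_degree_def by (rule member_le_sum) auto
  show "{(\<alpha>, \<beta>). \<alpha> + \<beta> = \<gamma>} \<subseteq> ?A \<times> ?A"
    using le by (auto simp: lookup_add) (metis add_leD1, metis add_leD2)
qed

definition mseries_mult ::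
    "('n::finite, 'a::field) mseries \<Rightarrow> ('n, 'a) mseries \<Rightarrow> ('n, 'a) mseries" where
  "mseries_mult F G = (\<lambda>\<gamma>. \<Sum>(\<alpha>, \<beta>)\<in>{(\<alpha>, \<beta>). \<alpha> + \<beta> = \<gamma>}. F \<alpha> * G \<beta>)"

definition linear_form :: "'a::field ^ 'n \<Rightarrow> ('n::finite, 'a) mpoly" where
  "linear_form z = (\<Sum>i\<in>UNIV. Poly_Mapping.single (Poly_Mapping.single i 1) (z $ i))"

text \<open>The formal sum \<open>\<Sum>\<^sub>k (x \<cdot> z)\<^sup>k / k!\<close> is taken coefficientwise; by the following lemma each
  coefficient receives a contribution from one \<open>k\<close> only.\<close>

lemma lookup_linear_form_power:
  "poly_mapping.lookup (linear_form z ^ k) \<gamma> \<noteq> 0 \<Longrightarrow> total_degree \<gamma> = k"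
proof (induction k arbitrary: \<gamma>)
  case 0
  then show ?case by (auto simp: lookup_one total_degree_def when_def split: if_splits)
next
  case (Suc k)
  have "\<gamma> \<in> Poly_Mapping.keys (linear_form z * linear_form z ^ k)"
    using Suc.prems by (simp add: in_keys_iff)
  then obtain \<alpha> \<beta> where *: "\<gamma> = \<alpha> + \<beta>" "\<alpha> \<in> Poly_Mapping.keys (linear_form z)" "\<beta> \<in> Poly_Mapping.keys (linear_form z ^ k)"
    using keys_mult by blast
  have "total_degree \<alpha> = 1"
  proof -
    have "\<exists>i. \<alpha> = Poly_Mapping.single i 1"
      using *(2) by (auto simp: linear_form_def in_keys_iff lookup_sum lookup_single when_def
          elim!: sum.not_neutral_contains_not_neutral split: if_splits)
    then show ?thesis by (auto simp: total_degree_def lookup_single when_def)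
  qed
  moreover have "total_degree \<beta> = k" using Suc.IH *(3) by (simp add: in_keys_iff)
  ultimately show ?case by (simp add: *(1) total_degree_def lookup_add sum.distrib)
qed

definition exp_series :: "'a::real_normed_field ^ 'n \<Rightarrow> ('n::finite, 'a) mseries" where
  "exp_series z = (\<lambda>\<gamma>. suminf (\<lambda>k. poly_mapping.lookup (linear_form z ^ k) \<gamma> / fact k))"

definition exp_poly :: "'a::real_normed_field ^ 'n \<Rightarrow> ('n::finite, 'a) mpoly \<Rightarrow> ('n, 'a) mseries" where
  "exp_poly z P = mseries_mult (exp_series z) (poly_mapping.lookup P)"


section \<open>Monomial orders and reverse reduced sets\<close>

text \<open>\<open>ord \<alpha> \<beta>\<close> is the strict relation \<open>x\<^sup>\<alpha> \<prec> x\<^sup>\<beta>\<close>.\<close>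

definition monomial_order :: "('n monom \<Rightarrow> 'n monom \<Rightarrow> bool) \<Rightarrow> bool" where
  "monomial_order ord \<longleftrightarrow> irreflp ord \<and> transp ord \<and> totalp ord \<and> wfp ord \<and>
    (\<forall>\<alpha> \<beta> \<gamma>. ord \<alpha> \<beta> \<longrightarrow> ord (\<alpha> + \<gamma>) (\<beta> + \<gamma>))"

definition graded_order :: "('n::finite monom \<Rightarrow> 'n monom \<Rightarrow> bool) \<Rightarrow> bool" where
  "graded_order ord \<longleftrightarrow> monomial_order ord \<and>
    (\<forall>\<alpha> \<beta>. total_degree \<alpha> < total_degree \<beta> \<longrightarrow> ord \<alpha> \<beta>)"

definition mseries_support :: "('n, 'a::zero) mseries \<Rightarrow> 'n monom set" where
  "mseries_support F = {\<alpha>. F \<alpha> \<noteq> 0}"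

definition lm :: "('n monom \<Rightarrow> 'n monom \<Rightarrow> bool) \<Rightarrow> ('n, 'a::zero) mseries \<Rightarrow> 'n monom" where
  "lm ord F = (THE \<alpha>. \<alpha> \<in> mseries_support F \<and>
    (\<forall>\<beta>\<in>mseries_support F. \<beta> \<noteq> \<alpha> \<longrightarrow> ord \<alpha> \<beta>))"

definition reverse_reduced ::
    "('n monom \<Rightarrow> 'n monom \<Rightarrow> bool) \<Rightarrow> 'i set \<Rightarrow> ('i \<Rightarrow> ('n, 'a::field) mseries) \<Rightarrow> bool" where
  "reverse_reduced ord I R \<longleftrightarrow> finite I \<and> func.independent_family I R \<and>
    (\<forall>k\<in>I. R k (lm ord (R k)) = 1) \<and>
    (\<forall>k\<in>I. \<forall>k'\<in>I. k \<noteq> k' \<longrightarrow> lm ord (R k) \<notin> mseries_support (R k'))"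

text \<open>\<open>R\<close> has the same number of elements as the family \<open>F\<close> since both are indexed by \<open>I\<close>.\<close>

definition reverse_reduced_set_of ::
    "('n monom \<Rightarrow> 'n monom \<Rightarrow> bool) \<Rightarrow> 'i set \<Rightarrow> ('i \<Rightarrow> ('n, 'a::field) mseries) \<Rightarrow>
      ('i \<Rightarrow> ('n, 'a) mseries) \<Rightarrow> bool" where
  "reverse_reduced_set_of ord I F R \<longleftrightarrow>
    reverse_reduced ord I R \<and> func.span (R ` I) = func.span (F ` I)"


section \<open>Minimal monomial bases\<close>

definition proper_interpolation_basis ::
    "(('n, 'a::field) mpoly \<Rightarrow> 'a) set \<Rightarrow> 'n monom set \<Rightarrow> bool" where
  "proper_interpolation_basis \<Delta> T \<longleftrightarrow> finite T \<and>
    (\<exists>L. func.independent_family {1..card T} L \<and> \<Delta> = func.span (L ` {1..card T}) \<and>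
      (\<forall>c. \<exists>!p. p \<in> monom_span T \<and> (\<forall>i\<in>{1..card T}. L i p = c i)))"

text \<open>The choice of the basis \<open>L\<close> of \<open>\<Delta>\<close> is immaterial:\<close>

lemma proper_interpolation_basis_iff:
  fixes L :: "nat \<Rightarrow> ('n, 'a::field) mpoly \<Rightarrow> 'a"
  assumes "finite T" "func.independent_family {1..card T} L"
  shows "proper_interpolation_basis (func.span (L ` {1..card T})) T \<longleftrightarrow>
    (\<forall>c. \<exists>!p. p \<in> monom_span T \<and> (\<forall>i\<in>{1..card T}. L i p = c i))"
proof
  let ?I = "{1..card T}"
  assume "proper_interpolation_basis (func.span (L ` ?I)) T"
  then obtain L' where L': "func.span (L ` ?I) = func.span (L' ` ?I)"
    and ex1: "\<And>c. \<exists>!p. p \<in> monom_span T \<and> (\<forall>i\<in>?I. L' i p = c i)"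
    by (auto simp: proper_interpolation_basis_def)
  have inj: "inj_on L ?I" and ind: "func.independent (L ` ?I)"
    using assms(2) by (auto simp: func.independent_family_def)
  have sub_eq: "func.subspace {l. l p = l q}" for p q :: "('n, 'a) mpoly"
    by (auto simp: func.subspace_def fun_scale_def)
  show "\<forall>c. \<exists>!p. p \<in> monom_span T \<and> (\<forall>i\<in>?I. L i p = c i)"
  proof
    fix c
    interpret vs: vector_space_pair fun_scale "(*) :: 'a \<Rightarrow> 'a \<Rightarrow> 'a"
      by unfold_locales (auto simp: algebra_simps fun_scale_def)
    obtain \<phi> where lin: "Vector_Spaces.linear fun_scale (*) \<phi>"
      and \<phi>: "\<forall>l\<in>L ` ?I. \<phi> l = c (inv_into ?I L l)"
      using vs.linear_independent_extend[OF ind, of "\<lambda>l. c (inv_into ?I L l)"] by blast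
    interpret \<phi>: Vector_Spaces.linear fun_scale "(*)" \<phi> by (fact lin)
    obtain p where p: "p \<in> monom_span T" "\<forall>i\<in>?I. L' i p = \<phi> (L' i)"
      using ex1[of "\<lambda>i. \<phi> (L' i)"] by blast
    have "func.subspace {l. l p = \<phi> l}"
      by (auto simp: func.subspace_def fun_scale_def \<phi>.add \<phi>.zero \<phi>.scale[unfolded fun_scale_def])
    then have "func.span (L' ` ?I) \<subseteq> {l. l p = \<phi> l}"
      using p by (intro func.span_minimal) auto
    then have "L i p = c i" if "i \<in> ?I" for i
      using that \<phi> inj L' func.span_base[of "L i" "L ` ?I"] by (auto simp: subset_iff)
    moreover have "q = p" if q: "q \<in> monom_span T" "\<forall>i\<in>?I. L i q = c i" for q
    proof -
      have "func.span (L ` ?I) \<subseteq> {l. l q = l p}"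
        using q(2) calculation by (intro func.span_minimal sub_eq) auto
      then have "L' i q = L' i p" if "i \<in> ?I" for i
        using that L' func.span_base[of "L' i" "L' ` ?I"] by (auto simp: subset_iff)
      then show ?thesis using ex1[of "\<lambda>i. L' i p"] p(1) q(1) by blast
    qed
    ultimately show "\<exists>!p. p \<in> monom_span T \<and> (\<forall>i\<in>?I. L i p = c i)"
      using p(1) by blast
  qed
qed (use assms in \<open>auto simp: proper_interpolation_basis_def\<close>)

definition minimal_monomial_basis ::
    "('n monom \<Rightarrow> 'n monom \<Rightarrow> bool) \<Rightarrow> (('n, 'a::field) mpoly \<Rightarrow> 'a) set \<Rightarrow> 'n monom set \<Rightarrow> bool" where
  "minimal_monomial_basis ord \<Delta> T \<longleftrightarrow> proper_interpolation_basis \<Delta> T \<and>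
    (\<forall>\<alpha>\<in>T. \<forall>\<beta>. ord \<beta> \<alpha> \<longrightarrow> \<not> proper_interpolation_basis \<Delta> (insert \<beta> (T - {\<alpha>})))"

end

theory Submission
  imports Defs
begin

text \<open>
  The functional \<open>\<delta>\<^sub>z \<circ> P(D)\<close> sends \<open>x\<^sup>\<gamma>\<close> to \<open>\<gamma>!\<close> times the \<open>\<gamma>\<close>-coefficient of \<open>e\<^bsup>x\<cdot>z\<^esup> P(x)\<close>, so
  interpolation conditions may be read off a space \<open>V\<close> of power series: \<open>T\<close> is a proper
  interpolation basis iff \<open>|T| = dim V\<close> and no nonzero series in \<open>V\<close> has vanishing coefficients on
  \<open>T\<close>.  On the least monomials of a reverse reduced basis \<open>R\<^sub>k\<close> of \<open>V\<close> the coefficient matrix is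
  the identity.  Replacing \<open>lm(R\<^sub>k)\<close> by a lower monomial makes \<open>R\<^sub>k\<close> vanish on the new set, whence
  minimality.  Conversely, if a proper \<open>T\<close> contains some \<open>\<alpha>\<close> that is not a least monomial, take \<open>F\<close>
  in \<open>V\<close> with coefficient \<open>1\<close> at \<open>\<alpha>\<close> and \<open>0\<close> on the rest of \<open>T\<close>.  Some \<open>R\<^sub>k\<close> occurring in \<open>F\<close> has
  \<open>\<alpha>\<close> in its support; then \<open>lm(R\<^sub>k) \<prec> \<alpha>\<close>, and \<open>F\<close> does not vanish at \<open>lm(R\<^sub>k)\<close>, so \<open>\<alpha>\<close> can be
  exchanged for \<open>lm(R\<^sub>k)\<close> and \<open>T\<close> is not minimal.
\<close>

section \<open>Explicit form of the Birkhoff functionals\<close>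

definition monom_fact :: "'n::finite monom \<Rightarrow> 'a::field_char_0" where
  "monom_fact \<gamma> = (\<Prod>i\<in>UNIV. fact (poly_mapping.lookup \<gamma> i))"

definition monom_eval :: "'a::field ^ 'n \<Rightarrow> 'n::finite monom \<Rightarrow> 'a" where
  "monom_eval z \<gamma> = (\<Prod>i\<in>UNIV. (z $ i) ^ poly_mapping.lookup \<gamma> i)"

text \<open>This is the value of \<open>F(D) p\<close> at the origin: there
  \<open>D^\<gamma>\<close> retains only the \<gamma>-term of \<open>p\<close> and multiplies its
  coefficient by \<gamma>!.\<close>

definition pairing :: "('n::finite, 'a::field_char_0) mseries \<Rightarrow> ('n, 'a) mpoly \<Rightarrow> 'a" where
  "pairing F p = (\<Sum>\<gamma>\<in>Poly_Mapping.keys p. monom_fact \<gamma> * F \<gamma> * poly_mapping.lookup p \<gamma>)"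

lemma monom_fact_nonzero [simp]: "monom_fact \<gamma> \<noteq> (0::'a::field_char_0)"
  by (simp add: monom_fact_def)

lemma monom_fact_add_single:
  "monom_fact (\<gamma> + Poly_Mapping.single i 1) =
    (of_nat (poly_mapping.lookup \<gamma> i + 1) * monom_fact \<gamma> :: 'a::field_char_0)"
proof -
  have "monom_fact (\<gamma> + Poly_Mapping.single i 1) =
      (\<Prod>j\<in>UNIV. (if j = i then of_nat (poly_mapping.lookup \<gamma> i + 1) else 1) * (fact (poly_mapping.lookup \<gamma> j) :: 'a))"
    unfolding monom_fact_def by (rule prod.cong) (auto simp: lookup_add lookup_single)
  then show ?thesis by (simp add: prod.distrib monom_fact_def)
qed

lemma monom_eval_add_single:
  "monom_eval z (\<gamma> + Poly_Mapping.single i 1) = z $ i * monom_eval z \<gamma>"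
proof -
  have "monom_eval z (\<gamma> + Poly_Mapping.single i 1) =
      (\<Prod>j\<in>UNIV. (if j = i then z $ i else 1) * (z $ j) ^ poly_mapping.lookup \<gamma> j)"
    unfolding monom_eval_def by (rule prod.cong) (auto simp: lookup_add lookup_single)
  then show ?thesis by (simp add: prod.distrib monom_eval_def)
qed

section \<open>Coefficients of iterated partial derivatives\<close>

lemma lookup_mpoly_pderiv_funpow:
  fixes p :: "('n, 'a::field_char_0) mpoly"
  shows "poly_mapping.lookup ((mpoly_pderiv i ^^ k) p) \<gamma> =
    fact (poly_mapping.lookup \<gamma> i + k) / fact (poly_mapping.lookup \<gamma> i) *
      poly_mapping.lookup p (\<gamma> + Poly_Mapping.single i k)"
proof (induction k arbitrary: \<gamma>)
  case (Suc k)
  have "\<gamma> + Poly_Mapping.single i 1 + Poly_Mapping.single i k = \<gamma> + Poly_Mapping.single i (Suc k)"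
    by (simp add: add.assoc flip: single_add)
  then show ?case
    by (simp add: lookup_mpoly_pderiv Suc lookup_add fact_reduce field_simps del: of_nat_Suc)
qed simp

text \<open>Repeated differentiation in variable \<open>i\<close> contributes the factor (\<gamma>_i
  + \<alpha>_i)! / \<gamma>_i!, and these factors multiply along the fold that defines
  \<open>mpoly_D\<close>.\<close>

lemma lookup_mpoly_D:
  fixes f :: "('n::finite, 'a::field_char_0) mpoly"
  shows "poly_mapping.lookup (mpoly_D \<alpha> f) \<gamma> =
    monom_fact (\<gamma> + \<alpha>) / monom_fact \<gamma> * poly_mapping.lookup f (\<gamma> + \<alpha>)"
proof -
  let ?op = "\<lambda>i. mpoly_pderiv i ^^ poly_mapping.lookup \<alpha> i :: ('n, 'a) mpoly \<Rightarrow> ('n, 'a) mpoly"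
  let ?part = "\<lambda>A. \<Sum>i\<in>A. Poly_Mapping.single i (poly_mapping.lookup \<alpha> i)"
  interpret comp_fun_commute ?op by (rule comp_fun_commute_mpoly_D)
  \<comment> \<open>The fold is computed over an arbitrary set \<open>A\<close> of variables to
    allow induction; \<open>?part A\<close> is the part of \<alpha> supported on
    \<open>A\<close>.\<close>
  have "poly_mapping.lookup (Finite_Set.fold ?op f A) \<gamma> =
      (\<Prod>i\<in>A. fact (poly_mapping.lookup \<gamma> i + poly_mapping.lookup \<alpha> i) / fact (poly_mapping.lookup \<gamma> i)) *
      poly_mapping.lookup f (\<gamma> + ?part A)" for A
    using finite[of A]
  proof (induction A arbitrary: \<gamma> rule: finite_induct)
    case (insert i A)
    \<comment> \<open>Differentiation in the new variable \<open>i\<close> shifts \<gamma> only at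
      \<open>i\<close>, which lies outside \<open>A\<close>.\<close>
    have "(\<Prod>j\<in>A. fact (poly_mapping.lookup (\<gamma> + Poly_Mapping.single i (poly_mapping.lookup \<alpha> i)) j + poly_mapping.lookup \<alpha> j) /
          fact (poly_mapping.lookup (\<gamma> + Poly_Mapping.single i (poly_mapping.lookup \<alpha> i)) j)) =
        (\<Prod>j\<in>A. fact (poly_mapping.lookup \<gamma> j + poly_mapping.lookup \<alpha> j) / (fact (poly_mapping.lookup \<gamma> j) :: 'a))"
      using insert.hyps by (intro prod.cong) (auto simp: lookup_add lookup_single when_def)
    then show ?case
      using insert.hyps
      by (simp add: lookup_mpoly_pderiv_funpow insert.IH add.assoc)
  qed simp
  from this[of UNIV] have "poly_mapping.lookup (mpoly_D \<alpha> f) \<gamma> =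
      (\<Prod>i\<in>UNIV. fact (poly_mapping.lookup \<gamma> i + poly_mapping.lookup \<alpha> i) / fact (poly_mapping.lookup \<gamma> i)) *
      poly_mapping.lookup f (\<gamma> + ?part UNIV)"
    by (simp add: mpoly_D_def)
  moreover have "?part UNIV = \<alpha>"
    by (rule poly_mapping_eqI) (simp add: lookup_sum lookup_single when_def)
  ultimately show ?thesis
    by (simp add: monom_fact_def prod_dividef lookup_add)
qed

section \<open>Coefficients of powers of a linear form and of the exponential series\<close>

lemma lookup_single_mult:
  fixes q :: "('n, 'a::field) mpoly"
  shows "poly_mapping.lookup (Poly_Mapping.single \<alpha> c * q) (\<beta> + \<alpha>) = c * poly_mapping.lookup q \<beta>"
proof -
  have eq: "\<beta> + \<alpha> = \<alpha> + r \<longleftrightarrow> r = \<beta>" for r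
    by (metis add.commute add_left_cancel)
  have "poly_mapping.lookup (Poly_Mapping.single \<alpha> c * q) (\<beta> + \<alpha>) =
      Sum_any (\<lambda>l. c * Sum_any (\<lambda>r. poly_mapping.lookup q r when r = \<beta>) when l = \<alpha>)"
    unfolding lookup_mult lookup_single
    by (rule Sum_any.cong) (auto simp: when_def eq)
  then show ?thesis by simp
qed

lemma lookup_single_mult_eq_0:
  fixes q :: "('n, 'a::field) mpoly"
  assumes "poly_mapping.lookup \<gamma> i = 0"
  shows "poly_mapping.lookup (Poly_Mapping.single (Poly_Mapping.single i 1) c * q) \<gamma> = 0"
proof (rule ccontr)
  assume "poly_mapping.lookup (Poly_Mapping.single (Poly_Mapping.single i 1) c * q) \<gamma> \<noteq> 0"
  then have "\<gamma> \<in> Poly_Mapping.keys (Poly_Mapping.single (Poly_Mapping.single i 1) c * q)"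
    by (simp add: in_keys_iff)
  then obtain \<alpha> \<beta> where "\<gamma> = \<alpha> + \<beta>" "\<alpha> \<in> Poly_Mapping.keys (Poly_Mapping.single (Poly_Mapping.single i (1::nat)) c)"
    using keys_mult by blast
  with assms show False by (auto simp: lookup_add split: if_splits)
qed

text \<open>Multinomial theorem. When one factor \<open>linear_form z\<close> is split off, variable
  \<open>i\<close> contributes \<gamma>_i times a term independent of \<open>i\<close>, and the
  exponents \<gamma>_i add up to \<open>k + 1\<close>.\<close>

lemma lookup_linear_form_power_eq:
  fixes z :: "'a::field_char_0 ^ 'n::finite"
  shows "poly_mapping.lookup (linear_form z ^ k) \<gamma> =
    (if total_degree \<gamma> = k then fact k * monom_eval z \<gamma> / monom_fact \<gamma> else 0)"
proof (cases "total_degree \<gamma> = k")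
  case True
  then have "poly_mapping.lookup (linear_form z ^ k) \<gamma> = fact k * monom_eval z \<gamma> / monom_fact \<gamma>"
  proof (induction k arbitrary: \<gamma>)
    case 0
    then have "\<gamma> = 0" by (intro poly_mapping_eqI) (simp add: total_degree_def)
    then show ?case by (simp add: monom_eval_def monom_fact_def lookup_one)
  next
    case (Suc k)
    \<comment> \<open>If \<gamma>_i = 0, both sides vanish; otherwise the induction hypothesis is
      applied to \<gamma> with its \<open>i\<close>-th exponent lowered by one.\<close>
    have "poly_mapping.lookup (Poly_Mapping.single (Poly_Mapping.single i 1) (z $ i) * linear_form z ^ k) \<gamma> =
        of_nat (poly_mapping.lookup \<gamma> i) * (fact k * monom_eval z \<gamma> / monom_fact \<gamma>)" for i
    proof (cases "poly_mapping.lookup \<gamma> i = 0")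
      case True
      then show ?thesis by (simp add: lookup_single_mult_eq_0 del: One_nat_def)
    next
      case False
      define \<delta> where "\<delta> = \<gamma> - Poly_Mapping.single i 1"
      have \<gamma>: "\<gamma> = \<delta> + Poly_Mapping.single i 1"
        using False unfolding \<delta>_def
        by (intro poly_mapping_eqI) (auto simp: lookup_add lookup_minus lookup_single when_def)
      have "total_degree \<delta> = k"
        using Suc.prems by (simp add: \<gamma> total_degree_def lookup_add lookup_single when_def sum.distrib)
      then have "poly_mapping.lookup (linear_form z ^ k) \<delta> = fact k * monom_eval z \<delta> / monom_fact \<delta>"
        by (rule Suc.IH)
      moreover have "poly_mapping.lookup \<gamma> i = poly_mapping.lookup \<delta> i + 1"
        by (simp add: \<gamma> lookup_add)
      moreover have "(of_nat (poly_mapping.lookup \<delta> i + 1) :: 'a) \<noteq> 0"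
        by (simp del: of_nat_add of_nat_Suc)
      ultimately show ?thesis
        unfolding \<gamma> lookup_single_mult monom_fact_add_single monom_eval_add_single
        by (simp add: lookup_add del: of_nat_Suc of_nat_add)
    qed
    then have "poly_mapping.lookup (linear_form z ^ Suc k) \<gamma> =
        (\<Sum>i\<in>UNIV. of_nat (poly_mapping.lookup \<gamma> i)) * (fact k * monom_eval z \<gamma> / monom_fact \<gamma>)"
      by (simp add: linear_form_def[of z] sum_distrib_right sum_divide_distrib lookup_sum flip: linear_form_def)
    also have "(\<Sum>i\<in>UNIV. of_nat (poly_mapping.lookup \<gamma> i)) = (of_nat (Suc k) :: 'a)"
      unfolding Suc.prems[symmetric] total_degree_def by simp
    finally show ?case by (simp add: algebra_simps)
  qed
  with True show ?thesis by simp
qed (use lookup_linear_form_power in auto)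

text \<open>Only \<open>k = total_degree \<gamma>\<close> contributes to the coefficient, and there
  the factor \<open>fact k\<close> cancels.\<close>

lemma exp_series_eq: "exp_series z \<gamma> = monom_eval z \<gamma> / monom_fact \<gamma>"
proof -
  have "exp_series z \<gamma> = (\<Sum>k\<in>{total_degree \<gamma>}. poly_mapping.lookup (linear_form z ^ k) \<gamma> / fact k)"
    unfolding exp_series_def by (rule suminf_finite) (auto simp: lookup_linear_form_power_eq)
  then show ?thesis by (simp add: lookup_linear_form_power_eq)
qed

section \<open>Birkhoff functionals as pairings with power series\<close>

text \<open>Allowing any finite superset of the keys lets sums for different polynomials share one
  index set.\<close>

lemma mpoly_eval_eq_sum:
  assumes "finite S" "Poly_Mapping.keys p \<subseteq> S"
  shows "mpoly_eval z p = (\<Sum>\<gamma>\<in>S. poly_mapping.lookup p \<gamma> * monom_eval z \<gamma>)"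
  unfolding mpoly_eval_def monom_eval_def
  using assms by (intro sum.mono_neutral_left) (auto simp: in_keys_iff)

lemma pairing_eq_sum:
  assumes "finite S" "Poly_Mapping.keys p \<subseteq> S"
  shows "pairing F p = (\<Sum>\<gamma>\<in>S. monom_fact \<gamma> * F \<gamma> * poly_mapping.lookup p \<gamma>)"
  unfolding pairing_def
  using assms by (intro sum.mono_neutral_left) (auto simp: in_keys_iff)

lemma mpoly_eval_add: "mpoly_eval z (p + q) = mpoly_eval z p + mpoly_eval z q"
  by (simp add: mpoly_eval_eq_sum[of "Poly_Mapping.keys p \<union> Poly_Mapping.keys q"] keys_add
      lookup_add sum.distrib distrib_right)

lemma mpoly_eval_scale: "mpoly_eval z (mpoly_scale c p) = c * mpoly_eval z p"
proof -
  have "Poly_Mapping.keys (mpoly_scale c p) \<subseteq> Poly_Mapping.keys p"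
    by (auto simp: in_keys_iff)
  then show ?thesis
    by (simp add: mpoly_eval_eq_sum[of "Poly_Mapping.keys p"] sum_distrib_left mult.assoc)
qed

lemma mpoly_eval_sum: "mpoly_eval z (sum f A) = (\<Sum>x\<in>A. mpoly_eval z (f x))"
  by (induction A rule: infinite_finite_induct) (auto simp: mpoly_eval_add mpoly_eval_def[of z 0])

text \<open>Both sides are the same double sum over \<alpha> and \<beta> with summand
  \<open>?c \<alpha> \<beta>\<close>. The differential operator groups it by \<beta>, the product of
  power series by \<gamma> = \<alpha> + \<beta>.\<close>

lemma birkhoff_functional_eq_pairing: "birkhoff_functional z P = pairing (exp_poly z P)"
proof
  fix f
  let ?c = "\<lambda>\<alpha> \<beta>. poly_mapping.lookup P \<beta> * (monom_fact (\<alpha> + \<beta>) / monom_fact \<alpha> *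
    poly_mapping.lookup f (\<alpha> + \<beta>) * monom_eval z \<alpha>)"
  let ?S = "SIGMA \<gamma>:Poly_Mapping.keys f. {(\<alpha>, \<beta>). \<alpha> + \<beta> = \<gamma>}"
  let ?S' = "SIGMA \<beta>:Poly_Mapping.keys P. Poly_Mapping.keys (mpoly_D \<beta> f)"
  \<comment> \<open>The factorial quotient in \<open>lookup_mpoly_D\<close> is nonzero in
    characteristic 0, so no coefficient is lost beyond the shift by \<beta>.\<close>
  have keys: "\<alpha> \<in> Poly_Mapping.keys (mpoly_D \<beta> f) \<longleftrightarrow> \<alpha> + \<beta> \<in> Poly_Mapping.keys f" for \<alpha> \<beta>
    by (simp add: in_keys_iff lookup_mpoly_D)
  have "birkhoff_functional z P f = (\<Sum>\<beta>\<in>Poly_Mapping.keys P. \<Sum>\<alpha>\<in>Poly_Mapping.keys (mpoly_D \<beta> f). ?c \<alpha> \<beta>)"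
    unfolding birkhoff_functional_def mpoly_diffop_def mpoly_eval_sum mpoly_eval_scale
    unfolding mpoly_eval_eq_sum[OF finite_keys subset_refl] lookup_mpoly_D sum_distrib_left ..
  also have "\<dots> = (\<Sum>(\<beta>, \<alpha>)\<in>?S'. ?c \<alpha> \<beta>)"
    by (simp add: sum.Sigma)
  also have "\<dots> = (\<Sum>(\<gamma>, \<alpha>, \<beta>)\<in>{x \<in> ?S. snd (snd x) \<in> Poly_Mapping.keys P}. ?c \<alpha> \<beta>)"
    by (rule sum.reindex_bij_witness[where i = "\<lambda>(\<gamma>, \<alpha>, \<beta>). (\<beta>, \<alpha>)" and j = "\<lambda>(\<beta>, \<alpha>). (\<alpha> + \<beta>, \<alpha>, \<beta>)"])
      (auto simp only: keys snd_conv split: prod.splits)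
  \<comment> \<open>Decompositions with \<beta> outside the keys of \<open>P\<close> may be added,
    since their summands vanish.\<close>
  also have "\<dots> = (\<Sum>(\<gamma>, \<alpha>, \<beta>)\<in>?S. ?c \<alpha> \<beta>)"
  proof (rule sum.mono_neutral_left)
    show "finite ?S"
      by (intro finite_SigmaI finite_monom_decompositions) auto
    show "\<forall>x\<in>?S - {x \<in> ?S. snd (snd x) \<in> Poly_Mapping.keys P}. (case x of (\<gamma>, \<alpha>, \<beta>) \<Rightarrow> ?c \<alpha> \<beta>) = 0"
      by (clarsimp simp: in_keys_iff)
  qed blast
  also have "\<dots> = (\<Sum>\<gamma>\<in>Poly_Mapping.keys f. \<Sum>(\<alpha>, \<beta>)\<in>{(\<alpha>, \<beta>). \<alpha> + \<beta> = \<gamma>}. ?c \<alpha> \<beta>)"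
    by (subst sum.Sigma) (auto simp: finite_monom_decompositions)
  also have "\<dots> = pairing (exp_poly z P) f"
    unfolding pairing_def exp_poly_def mseries_mult_def sum_distrib_left sum_distrib_right exp_series_eq
    by (intro sum.cong refl) auto
  finally show "birkhoff_functional z P f = pairing (exp_poly z P) f" .
qed


section \<open>Interpolation in a span of power series\<close>

text \<open>The coefficients are attached to indices rather than to vectors, as suits families given
  by an indexing map.\<close>

lemma (in vector_space) span_family_obtain:
  assumes "finite I" "x \<in> span (f ` I)"
  obtains c where "x = (\<Sum>i\<in>I. scale (c i) (f i))"
proof -
  have "\<exists>c. x = (\<Sum>i\<in>I. scale (c i) (f i))"
    using assms(2)
  proof (induction rule: span_induct_alt)
    case base
    show ?case by (intro exI[of _ "\<lambda>_. 0"]) simp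
  next
    case (step a y b)
    then obtain c j where c: "b = (\<Sum>i\<in>I. scale (c i) (f i))" and j: "j \<in> I" "y = f j" by auto
    \<comment> \<open>The new multiple of \<open>y\<close> is credited to the single index
      \<open>j\<close> chosen with \<open>y = f j\<close>.\<close>
    have "(\<Sum>i\<in>I. scale (c i + (if i = j then a else 0)) (f i)) =
        b + (\<Sum>i\<in>I. if i = j then scale a y else 0)"
      unfolding c sum.distrib[symmetric] using j by (intro sum.cong) (auto simp: scale_left_distrib)
    also have "\<dots> = scale a y + b"
      using assms(1) j by simp
    finally show ?case by metis
  qed
  with that show ?thesis by blast
qed

lemma sum_fun_scale_apply: "(\<Sum>i\<in>I. fun_scale (c i) (f i)) x = (\<Sum>i\<in>I. c i * f i x)"
  by (induction I rule: infinite_finite_induct) (auto simp: fun_scale_def)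

text \<open>Evaluating a vanishing combination at the dual point \<open>x j\<close> isolates the
  coefficient of \<open>f j\<close>.\<close>

lemma func_independent_family_dual:
  assumes "finite I" "\<And>i j. i \<in> I \<Longrightarrow> j \<in> I \<Longrightarrow> f i (x j) = (if i = j then 1 else 0)"
  shows "func.independent_family I f"
proof -
  have inj: "inj_on f I"
    using assms(2) by (intro inj_onI) (metis zero_neq_one)
  have "func.independent (f ` I)"
  proof (rule func.independent_if_scalars_zero)
    fix u v
    assume sum0: "(\<Sum>v\<in>f ` I. fun_scale (u v) v) = 0" and "v \<in> f ` I"
    then obtain j where j: "j \<in> I" "v = f j" by blast
    have "0 = (\<Sum>i\<in>I. fun_scale (u (f i)) (f i)) (x j)"
      using sum0 inj by (simp add: sum.reindex)
    also have "\<dots> = (\<Sum>i\<in>I. if i = j then u v else 0)"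
      unfolding sum_fun_scale_apply using assms(2) j by (intro sum.cong) auto
    finally show "u v = 0" using assms(1) j by simp
  qed (use assms(1) in simp)
  with inj show ?thesis by (simp add: func.independent_family_def)
qed

text \<open>Restriction to \<open>T\<close> is injective on the span, so it keeps \<open>B\<close>
  independent. If the restriction of \<open>f\<close> were not in the image, adding it would give
  \<open>card B + 1 > card T\<close> independent vectors in a space spanned by \<open>card T\<close>
  indicator functions.\<close>

lemma func_span_interpolation:
  fixes B :: "('x \<Rightarrow> 'a::field) set"
  assumes "func.independent B" "finite T" "card T \<le> card B"
    and inj: "\<And>F. F \<in> func.span B \<Longrightarrow> (\<forall>t\<in>T. F t = 0) \<Longrightarrow> F = 0"
  obtains F where "F \<in> func.span B" "\<And>t. t \<in> T \<Longrightarrow> F t = f t"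
proof -
  \<comment> \<open>Restriction is modelled as extension by 0 outside \<open>T\<close>, so that it
    stays within one function space.\<close>
  define res where "res F = (\<lambda>x. if x \<in> T then F x else 0)" for F :: "'x \<Rightarrow> 'a"
  define \<delta> where "\<delta> t = (\<lambda>x. if x = t then 1 else 0 :: 'a)" for t :: 'x
  interpret res: module_hom fun_scale fun_scale res
    by unfold_locales (auto simp: res_def fun_scale_def fun_eq_iff)
  have inj_res: "inj_on res (func.span B)"
  proof (rule inj_onI)
    fix F G assume "F \<in> func.span B" "G \<in> func.span B" "res F = res G"
    then have "F - G = 0"
      by (intro inj func.span_diff) (auto simp: res_def fun_eq_iff split: if_splits)
    then show "F = G" by simp
  qed
  have res_span: "res F \<in> func.span (\<delta> ` T)" for F
  proof -
    have "res F = (\<Sum>t\<in>T. fun_scale (F t) (\<delta> t))"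
      using \<open>finite T\<close> by (intro ext) (auto simp: sum_fun_scale_apply res_def \<delta>_def if_distrib cong: if_cong)
    also have "\<dots> \<in> func.span (\<delta> ` T)"
      by (intro func.span_sum func.span_scale func.span_base) auto
    finally show ?thesis .
  qed
  have "res f \<in> func.span (res ` B)"
  proof (rule ccontr)
    assume notin: "res f \<notin> func.span (res ` B)"
    have "func.independent (res ` B)"
      using assms(1) inj_res by (rule res.independent_injective_image)
    with notin have "func.independent (insert (res f) (res ` B))"
      by (rule func.independent_insertI)
    moreover have "insert (res f) (res ` B) \<subseteq> func.span (\<delta> ` T)"
      using res_span by blast
    ultimately have bound: "finite (insert (res f) (res ` B)) \<and> card (insert (res f) (res ` B)) \<le> card (\<delta> ` T)"
      by (rule func.independent_span_bound[OF finite_imageI[OF \<open>finite T\<close>]])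
    have "res f \<notin> res ` B" using notin by (rule contrapos_nn) (rule func.span_base)
    moreover have "card (res ` B) = card B"
      using inj_res func.span_superset by (intro card_image) (rule inj_on_subset)
    ultimately have "Suc (card B) \<le> card (\<delta> ` T)" using bound by auto
    with \<open>card T \<le> card B\<close> card_image_le[OF \<open>finite T\<close>, of \<delta>] show False by linarith
  qed
  then obtain F where "F \<in> func.span B" "res F = res f"
    by (auto simp: res.span_image)
  with that show ?thesis by (metis res_def)
qed

section \<open>Proper interpolation bases in terms of power series coefficients\<close>

lemma pairing_single [simp]: "pairing F (Poly_Mapping.single \<gamma> c) = monom_fact \<gamma> * F \<gamma> * c"
  by (simp add: pairing_eq_sum[of "{\<gamma>}"])

text \<open>Pairing with single monomials recovers every coefficient, because the factorials are
  nonzero.\<close>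

lemma pairing_eq_iff [simp]: "pairing F = pairing G \<longleftrightarrow> F = G"
proof
  assume "pairing F = pairing G"
  then have "pairing F (Poly_Mapping.single \<gamma> 1) = pairing G (Poly_Mapping.single \<gamma> 1)" for \<gamma> by simp
  then show "F = G" by auto
qed simp

lemma module_hom_pairing: "module_hom fun_scale fun_scale pairing"
  by unfold_locales
    (auto simp: pairing_def fun_scale_def fun_eq_iff algebra_simps sum.distrib sum_distrib_left)

lemma monom_span_lookup_eq_0:
  assumes "p \<in> monom_span T" "\<gamma> \<notin> T"
  shows "poly_mapping.lookup p \<gamma> = 0"
proof -
  have "monom_span T \<subseteq> {p. poly_mapping.lookup p \<gamma> = 0}"
    unfolding monom_span_def using assms(2)
    by (intro mpoly.span_minimal) (auto simp: mpoly.subspace_def lookup_add lookup_single when_def)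
  with assms(1) show ?thesis by blast
qed

lemma single_in_monom_span:
  assumes "\<gamma> \<in> T"
  shows "Poly_Mapping.single \<gamma> c \<in> monom_span T"
proof -
  have "Poly_Mapping.single \<gamma> c = mpoly_scale c (Poly_Mapping.single \<gamma> 1)"
    by (rule poly_mapping_eqI) (simp add: lookup_single when_def)
  also have "\<dots> \<in> monom_span T"
    unfolding monom_span_def using assms by (intro mpoly.span_scale mpoly.span_base) blast
  finally show ?thesis .
qed

lemma pairing_monom_span:
  assumes "finite T" "p \<in> monom_span T"
  shows "pairing F p = (\<Sum>t\<in>T. monom_fact t * F t * poly_mapping.lookup p t)"
  using assms monom_span_lookup_eq_0[OF assms(2)]
  by (intro pairing_eq_sum) (auto simp: in_keys_iff)

text \<open>On \<open>monom_span T\<close> the functional \<open>pairing F\<close> sees only the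
  coefficients of \<open>F\<close> on \<open>T\<close>. Unisolvence therefore means that the
  dimensions agree and that a series of the span is determined by these coefficients.\<close>

lemma proper_interpolation_basis_pairing_iff:
  fixes R :: "'i \<Rightarrow> ('n::finite, 'a::field_char_0) mseries"
  assumes "finite I" and R: "func.independent_family I R"
  shows "proper_interpolation_basis (pairing ` func.span (R ` I)) T \<longleftrightarrow>
    finite T \<and> card T = card I \<and> (\<forall>F\<in>func.span (R ` I). (\<forall>t\<in>T. F t = 0) \<longrightarrow> F = 0)"
    (is "?L \<longleftrightarrow> ?R")
proof -
  interpret pairing: module_hom fun_scale fun_scale "pairing :: ('n, 'a) mseries \<Rightarrow> _"
    by (rule module_hom_pairing)
  have inj_pairing: "inj (pairing :: ('n, 'a) mseries \<Rightarrow> _)" by (simp add: inj_on_def)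
  from R have indep: "func.independent (R ` I)" and card_R: "card (R ` I) = card I"
    by (auto simp: func.independent_family_def card_image)
  show ?thesis
  proof
    assume ?L
    then obtain L where fin: "finite T" and L: "func.independent_family {1..card T} L"
      and span: "pairing ` func.span (R ` I) = func.span (L ` {1..card T})"
      and ex1: "\<And>c. \<exists>!p. p \<in> monom_span T \<and> (\<forall>i\<in>{1..card T}. L i p = c i)"
      by (auto simp: proper_interpolation_basis_def)
    have "card T = func.dim (L ` {1..card T})"
      using L by (simp add: func.independent_family_def func.dim_eq_card_independent card_image)
    also have "\<dots> = func.dim (pairing ` R ` I)"
      using span by (intro func.span_eq_dim) (simp add: pairing.span_image)
    also have "\<dots> = card (pairing ` R ` I)"
      using indep inj_pairing
      by (intro func.dim_eq_card_independent pairing.independent_inj_image)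
    also have "\<dots> = card I"
      using inj_pairing card_R by (simp add: card_image inj_on_subset[OF _ subset_UNIV])
    finally have card: "card T = card I" .
    have "F = 0" if F: "F \<in> func.span (R ` I)" "\<forall>t\<in>T. F t = 0" for F
    proof -
      have "pairing F \<in> func.span (L ` {1..card T})" using F(1) span by blast
      then obtain c where c: "pairing F = (\<Sum>i\<in>{1..card T}. fun_scale (c i) (L i))"
        using func.span_family_obtain[of "{1..card T}"] by blast
      have "c j = 0" if j: "j \<in> {1..card T}" for j
      proof -
        \<comment> \<open>\<open>p\<close> is the fundamental polynomial dual to \<open>L j\<close>;
          it is annihilated by \<open>pairing F\<close> because \<open>F\<close> vanishes on
          \<open>T\<close>.\<close>
        obtain p where p: "p \<in> monom_span T" "\<forall>i\<in>{1..card T}. L i p = (if i = j then 1 else 0)"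
          using ex1[of "\<lambda>i. if i = j then 1 else 0"] by blast
        have "0 = pairing F p" using F(2) by (simp add: pairing_monom_span[OF fin p(1)])
        also have "\<dots> = (\<Sum>i\<in>{1..card T}. if i = j then c i else 0)"
          unfolding c sum_fun_scale_apply using p(2) by (intro sum.cong) auto
        finally show ?thesis using j by simp
      qed
      then have "pairing F = pairing 0" unfolding c pairing.zero by (intro sum.neutral) simp
      then show ?thesis unfolding pairing_eq_iff .
    qed
    with fin card show ?R by blast
  next
    assume ?R
    then have fin: "finite T" and card: "card T = card I"
      and inj: "\<And>F. F \<in> func.span (R ` I) \<Longrightarrow> \<forall>t\<in>T. F t = 0 \<Longrightarrow> F = 0"
      by auto
    \<comment> \<open>The value 1 / t! compensates the factorial in \<open>pairing\<close>, so the
      functional of this series reads off the coefficient of the monomial \<open>t\<close> on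
      \<open>monom_span T\<close>.\<close>
    have "\<exists>F\<in>func.span (R ` I). \<forall>t'\<in>T. F t' = (if t' = t then 1 / monom_fact t else 0)" for t
      using func_span_interpolation[OF indep fin, of "\<lambda>t'. if t' = t then 1 / monom_fact t else 0"]
        inj card card_R by (metis order_refl)
    then obtain G where G: "\<And>t. G t \<in> func.span (R ` I)"
      and G_eq: "\<And>t t'. t' \<in> T \<Longrightarrow> G t t' = (if t' = t then 1 / monom_fact t else 0)"
      by metis
    obtain e where e: "bij_betw e {1..card T} T"
      using ex_bij_betw_nat_finite_1[OF fin] by blast
    then have e_in: "e i \<in> T" if "i \<in> {1..card T}" for i
      using that by (rule bij_betw_apply)
    have e_eq: "e i = e j \<longleftrightarrow> i = j" if "i \<in> {1..card T}" "j \<in> {1..card T}" for i j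
      using inj_on_eq_iff[OF bij_betw_imp_inj_on[OF e] that] .
    have e_surj: "\<exists>i\<in>{1..card T}. t = e i" if "t \<in> T" for t
      using that bij_betw_imp_surj_on[OF e] by blast
    define L where "L i = pairing (G (e i))" for i
    have L_monom_span: "L i p = poly_mapping.lookup p (e i)"
      if "i \<in> {1..card T}" "p \<in> monom_span T" for i p
    proof -
      have "L i p = (\<Sum>t\<in>T. if t = e i then poly_mapping.lookup p (e i) else 0)"
        unfolding L_def pairing_monom_span[OF fin that(2)] using G_eq
        by (intro sum.cong) auto
      then show ?thesis using e_in[OF that(1)] fin by simp
    qed
    have "func.independent_family {1..card T} L"
      by (rule func_independent_family_dual[where x = "\<lambda>j. Poly_Mapping.single (e j) 1"])
        (auto simp: L_monom_span single_in_monom_span e_in e_eq lookup_single when_def)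
    moreover have "pairing ` func.span (R ` I) = func.span (L ` {1..card T})"
    proof (intro equalityI image_subsetI)
      fix F assume F: "F \<in> func.span (R ` I)"
      \<comment> \<open>The subtracted sum interpolates \<open>F\<close> on \<open>T\<close>; the
        difference vanishes there and is 0 by injectivity.\<close>
      have "F - (\<Sum>t\<in>T. fun_scale (monom_fact t * F t) (G t)) = 0"
      proof (rule inj)
        show "F - (\<Sum>t\<in>T. fun_scale (monom_fact t * F t) (G t)) \<in> func.span (R ` I)"
          using F G by (intro func.span_diff func.span_sum func.span_scale)
        show "\<forall>t'\<in>T. (F - (\<Sum>t\<in>T. fun_scale (monom_fact t * F t) (G t))) t' = 0"
        proof
          fix t' assume t': "t' \<in> T"
          have "(\<Sum>t\<in>T. monom_fact t * F t * G t t') = (\<Sum>t\<in>T. if t = t' then F t else 0)"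
            using t' G_eq by (intro sum.cong) auto
          with t' fin show "(F - (\<Sum>t\<in>T. fun_scale (monom_fact t * F t) (G t))) t' = 0"
            by (simp add: sum_fun_scale_apply)
        qed
      qed
      then have "F = (\<Sum>t\<in>T. fun_scale (monom_fact t * F t) (G t))" by simp
      from arg_cong[OF this, of pairing]
      have "pairing F = (\<Sum>t\<in>T. fun_scale (monom_fact t * F t) (pairing (G t)))"
        unfolding pairing.sum pairing.scale .
      moreover have "pairing (G t) \<in> L ` {1..card T}" if "t \<in> T" for t
        using e_surj[OF that] unfolding L_def by blast
      ultimately show "pairing F \<in> func.span (L ` {1..card T})"
        by (simp only:) (intro func.span_sum func.span_scale func.span_base)
    next
      show "func.span (L ` {1..card T}) \<subseteq> pairing ` func.span (R ` I)"
      proof (rule func.span_minimal)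
        show "L ` {1..card T} \<subseteq> pairing ` func.span (R ` I)"
          using G by (auto simp: L_def)
        show "func.subspace (pairing ` func.span (R ` I))"
          unfolding pairing.span_image[symmetric] by (rule func.subspace_span)
      qed
    qed
    moreover have "\<exists>!p. p \<in> monom_span T \<and> (\<forall>i\<in>{1..card T}. L i p = c i)" for c
    proof (rule ex1I)
      \<comment> \<open>Since each \<open>L i\<close> extracts the coefficient at
        \<open>e i\<close>, the interpolant can be written down directly.\<close>
      let ?p = "\<Sum>i\<in>{1..card T}. Poly_Mapping.single (e i) (c i)"
      have p: "?p \<in> monom_span T"
        using e_in single_in_monom_span unfolding monom_span_def by (intro mpoly.span_sum) blast
      have "poly_mapping.lookup ?p (e i) = c i" if "i \<in> {1..card T}" for i
      proof -
        have "poly_mapping.lookup ?p (e i) = (\<Sum>j\<in>{1..card T}. if j = i then c i else 0)"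
          unfolding lookup_sum lookup_single using that e_eq by (intro sum.cong) (auto simp: when_def)
        with that show ?thesis by simp
      qed
      with p show "?p \<in> monom_span T \<and> (\<forall>i\<in>{1..card T}. L i ?p = c i)"
        by (simp add: L_monom_span)
      fix q assume q: "q \<in> monom_span T \<and> (\<forall>i\<in>{1..card T}. L i q = c i)"
      show "q = ?p"
      proof (rule poly_mapping_eqI)
        fix \<gamma>
        show "poly_mapping.lookup q \<gamma> = poly_mapping.lookup ?p \<gamma>"
        proof (cases "\<gamma> \<in> T")
          case True
          then obtain i where "i \<in> {1..card T}" "\<gamma> = e i" using e_surj by blast
          with q \<open>\<And>i. i \<in> {1..card T} \<Longrightarrow> poly_mapping.lookup ?p (e i) = c i\<close> show ?thesis
            using L_monom_span by metis
        qed (use q p monom_span_lookup_eq_0 in metis)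
      qed
    qed
    ultimately show ?L
      using fin unfolding proper_interpolation_basis_def by blast
  qed
qed


section \<open>Least monomials of reverse reduced sets\<close>

text \<open>Well-foundedness provides a minimal element even of an infinite support. Totality makes
  it least, and irreflexivity with transitivity makes it unique, so the description in
  \<open>lm\<close> denotes.\<close>

lemma lm_least:
  assumes "monomial_order ord" "F \<noteq> 0"
  shows "F (lm ord F) \<noteq> 0" and "F \<beta> \<noteq> 0 \<Longrightarrow> \<beta> \<noteq> lm ord F \<Longrightarrow> ord (lm ord F) \<beta>"
proof -
  let ?P = "\<lambda>\<alpha>. \<alpha> \<in> mseries_support F \<and> (\<forall>\<beta>\<in>mseries_support F. \<beta> \<noteq> \<alpha> \<longrightarrow> ord \<alpha> \<beta>)"
  have ord: "irreflp ord" "transp ord" "totalp ord" "wfp ord"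
    using assms(1) by (auto simp: monomial_order_def)
  have "mseries_support F \<noteq> {}"
    using assms(2) by (auto simp: mseries_support_def fun_eq_iff)
  then obtain \<alpha> where "\<alpha> \<in> mseries_support F" "\<forall>\<beta>\<in>mseries_support F. \<not> ord \<beta> \<alpha>"
    using ord(4)[unfolded wfp_iff_ex_minimal, rule_format, of "mseries_support F"] by metis
  then have "?P \<alpha>" using ord(3) by (auto simp: totalp_on_def)
  moreover have "\<gamma> = \<alpha>" if "?P \<gamma>" for \<gamma>
    using that \<open>?P \<alpha>\<close> ord(1,2) by (metis irreflpD transpD)
  ultimately have "?P (lm ord F)" unfolding lm_def by (rule theI)
  then show "F (lm ord F) \<noteq> 0" "F \<beta> \<noteq> 0 \<Longrightarrow> \<beta> \<noteq> lm ord F \<Longrightarrow> ord (lm ord F) \<beta>"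
    by (auto simp: mseries_support_def)
qed

text \<open>Letting \<open>T\<close> be arbitrary yields existence and uniqueness of the minimal
  basis at once.\<close>

lemma reverse_reduced_minimal_monomial_basis_iff:
  fixes R :: "'i \<Rightarrow> ('n::finite, 'a::field_char_0) mseries"
  assumes ord: "monomial_order ord" and red: "reverse_reduced ord I R"
  shows "minimal_monomial_basis ord (pairing ` func.span (R ` I)) T \<longleftrightarrow> T = (\<lambda>k. lm ord (R k)) ` I"
proof -
  let ?V = "func.span (R ` I)"
  let ?M = "(\<lambda>k. lm ord (R k)) ` I"
  let ?proper = "proper_interpolation_basis (pairing ` ?V)"
  have fin: "finite I" and fam: "func.independent_family I R"
    using red by (auto simp: reverse_reduced_def)
  have R_lm: "R k (lm ord (R k')) = (if k = k' then 1 else 0)" if "k \<in> I" "k' \<in> I" for k k'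
    using red that unfolding reverse_reduced_def mseries_support_def by auto
  have R_nonzero: "R k \<noteq> 0" if "k \<in> I" for k
    using R_lm[OF that that] by auto
  have R_in: "R k \<in> ?V" if "k \<in> I" for k
    using that by (intro func.span_base) simp
  \<comment> \<open>By \<open>R_lm\<close> the coordinates of \<open>F\<close> in the reduced basis
    are its coefficients at the least monomials.\<close>
  have expansion: "F x = (\<Sum>k\<in>I. F (lm ord (R k)) * R k x)" if F: "F \<in> ?V" for F x
  proof -
    obtain c where c: "F = (\<Sum>k\<in>I. fun_scale (c k) (R k))"
      using func.span_family_obtain[OF fin F] by blast
    have "F (lm ord (R k)) = c k" if "k \<in> I" for k
    proof -
      have "F (lm ord (R k)) = (\<Sum>j\<in>I. if j = k then c k else 0)"
        unfolding c sum_fun_scale_apply using R_lm that by (intro sum.cong) auto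
      with fin that show ?thesis by simp
    qed
    then show ?thesis by (simp add: c sum_fun_scale_apply)
  qed
  note proper_iff = proper_interpolation_basis_pairing_iff[OF fin fam]
  have indep: "func.independent (R ` I)" and card_R: "card (R ` I) = card I"
    using fam by (auto simp: func.independent_family_def card_image)
  have "inj_on (\<lambda>k. lm ord (R k)) I"
    using R_lm by (intro inj_onI) (metis zero_neq_one)
  then have card_M: "card ?M = card I" by (rule card_image)
  have "F = 0" if "F \<in> ?V" "\<forall>t\<in>?M. F t = 0" for F
  proof
    show "F x = 0 x" for x
      unfolding expansion[OF that(1), of x] using that(2) by (auto intro: sum.neutral)
  qed
  then have M_proper: "?proper ?M"
    unfolding proper_iff using fin card_M by blast
  have M_minimal: "\<not> ?proper (insert \<beta> (?M - {\<alpha>}))" if "\<alpha> \<in> ?M" "ord \<beta> \<alpha>" for \<alpha> \<beta>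
  proof -
    obtain k where k: "k \<in> I" "\<alpha> = lm ord (R k)" using \<open>\<alpha> \<in> ?M\<close> by blast
    \<comment> \<open>Nothing below the least monomial of \<open>R k\<close> lies in its
      support.\<close>
    have "R k \<beta> = 0"
      using lm_least(2)[OF ord R_nonzero[OF k(1)], of \<beta>] \<open>ord \<beta> \<alpha>\<close> ord
      unfolding k(2) monomial_order_def by (metis irreflpD transpD)
    then have "\<forall>t\<in>insert \<beta> (?M - {\<alpha>}). R k t = 0"
      using R_lm k by (auto split: if_splits)
    with R_in[OF k(1)] R_nonzero[OF k(1)] show ?thesis
      unfolding proper_iff by blast
  qed
  have "T = ?M" if T: "minimal_monomial_basis ord (pairing ` ?V) T"
  proof -
    have "?proper T" using T by (simp add: minimal_monomial_basis_def)
    then have finT: "finite T" and cardT: "card T = card I"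
      and injT: "\<And>F. F \<in> ?V \<Longrightarrow> \<forall>t\<in>T. F t = 0 \<Longrightarrow> F = 0"
      unfolding proper_iff by auto
    have "\<alpha> \<in> ?M" if \<alpha>: "\<alpha> \<in> T" for \<alpha>
    proof (rule ccontr)
      assume \<alpha>_M: "\<alpha> \<notin> ?M"
      obtain F where F: "F \<in> ?V" "\<And>t. t \<in> T \<Longrightarrow> F t = (if t = \<alpha> then 1 else 0)"
        using func_span_interpolation[OF indep finT, of "\<lambda>t. if t = \<alpha> then 1 else 0"]
          injT cardT card_R by (metis order_refl)
      \<comment> \<open>The sum is the expansion of \<open>F \<alpha> = 1\<close>. A nonzero summand
        supplies the \<open>k\<close> whose least monomial replaces \<alpha>.\<close>
      have "(\<Sum>k\<in>I. F (lm ord (R k)) * R k \<alpha>) \<noteq> 0"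
        unfolding expansion[OF F(1), symmetric] using F(2)[OF \<alpha>] by simp
      then obtain k where k: "k \<in> I" "F (lm ord (R k)) \<noteq> 0" "R k \<alpha> \<noteq> 0"
        by (rule sum.not_neutral_contains_not_neutral) simp
      define \<beta> where "\<beta> = lm ord (R k)"
      have "\<beta> \<noteq> \<alpha>" using \<alpha>_M k(1) by (auto simp: \<beta>_def)
      then have "ord \<beta> \<alpha>"
        using lm_least(2)[OF ord R_nonzero[OF k(1)] k(3)] by (simp add: \<beta>_def)
      have "\<beta> \<notin> T" using F(2)[of \<beta>] k(2) \<open>\<beta> \<noteq> \<alpha>\<close> by (auto simp: \<beta>_def)
      have "H = 0" if H: "H \<in> ?V" "\<forall>t\<in>insert \<beta> (T - {\<alpha>}). H t = 0" for H
      proof -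
        \<comment> \<open>Off \<alpha> both terms vanish on \<open>T\<close>, and at \<alpha> they
          cancel because \<open>F \<alpha> = 1\<close>. Hence \<open>H\<close> is a multiple of
          \<open>F\<close>, and \<open>F \<beta> \<noteq> 0 = H \<beta>\<close> forces the factor to
          be 0.\<close>
        have "H - fun_scale (H \<alpha>) F = 0"
        proof (rule injT)
          show "H - fun_scale (H \<alpha>) F \<in> ?V"
            using H(1) F(1) by (intro func.span_diff func.span_scale)
          show "\<forall>t\<in>T. (H - fun_scale (H \<alpha>) F) t = 0"
            using H(2) F(2) by (auto simp: fun_scale_def)
        qed
        then have H_eq: "H = fun_scale (H \<alpha>) F" by simp
        from fun_cong[OF this, of \<beta>] H(2) k(2) have "H \<alpha> = 0"
          by (simp add: fun_scale_def \<beta>_def)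
        with H_eq show ?thesis by simp
      qed
      moreover have "card (insert \<beta> (T - {\<alpha>})) = card I"
        using \<open>\<beta> \<notin> T\<close> finT cardT card_Suc_Diff1[OF finT \<alpha>] by simp
      ultimately have "?proper (insert \<beta> (T - {\<alpha>}))"
        unfolding proper_iff using finT by auto
      with T \<alpha> \<open>ord \<beta> \<alpha>\<close> show False
        unfolding minimal_monomial_basis_def by blast
    qed
    then show ?thesis
      using fin cardT card_M by (intro card_subset_eq) auto
  qed
  with M_proper M_minimal show ?thesis
    unfolding minimal_monomial_basis_def by blast
qed

theorem theorem4p1:
  fixes ord :: "'n::finite monom \<Rightarrow> 'n monom \<Rightarrow> bool"
    and m :: nat and s :: "nat \<Rightarrow> nat"
    and z :: "nat \<Rightarrow> 'a::real_normed_field ^ 'n"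
    and P :: "nat \<Rightarrow> nat \<Rightarrow> ('n, 'a) mpoly"
    and R :: "nat \<Rightarrow> nat \<Rightarrow> ('n, 'a) mseries"
  assumes "graded_order ord"
    and "inj_on z {1..m}"
    and "\<And>i. i \<in> {1..m} \<Longrightarrow> mpoly.independent_family {1..s i} (P i)"
    and "reverse_reduced_set_of ord (SIGMA i:{1..m}. {1..s i})
           (\<lambda>(i, j). exp_poly (z i) (P i j)) (\<lambda>(i, j). R i j)"
  shows "\<forall>T. minimal_monomial_basis ord
             (func.span {birkhoff_functional (z i) (P i j) | i j. i \<in> {1..m} \<and> j \<in> {1..s i}}) T
           \<longleftrightarrow> T = {lm ord (R i j) | i j. i \<in> {1..m} \<and> j \<in> {1..s i}}"
proof -
  let ?I = "SIGMA i:{1..m}. {1..s i}"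
  let ?E = "\<lambda>(i, j). exp_poly (z i) (P i j)" and ?R = "\<lambda>(i, j). R i j"
  have ord: "monomial_order ord" using assms(1) by (simp add: graded_order_def)
  have red: "reverse_reduced ord ?I ?R" and span: "func.span (?R ` ?I) = func.span (?E ` ?I)"
    using assms(4) by (auto simp: reverse_reduced_set_of_def)
  have "{birkhoff_functional (z i) (P i j) | i j. i \<in> {1..m} \<and> j \<in> {1..s i}} = pairing ` ?E ` ?I"
    unfolding birkhoff_functional_eq_pairing by (force simp: image_iff)
  \<comment> \<open>Linearity of \<open>pairing\<close> carries the span of the exponential family
    onto that of the functionals, and reverse reduction preserves the former.\<close>
  then have "func.span {birkhoff_functional (z i) (P i j) | i j. i \<in> {1..m} \<and> j \<in> {1..s i}} =
      pairing ` func.span (?R ` ?I)"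
    by (simp only: span module_hom.span_image[OF module_hom_pairing])
  moreover have "{lm ord (R i j) | i j. i \<in> {1..m} \<and> j \<in> {1..s i}} = (\<lambda>k. lm ord (?R k)) ` ?I"
    by (force simp: image_iff)
  ultimately show ?thesis
    using reverse_reduced_minimal_monomial_basis_iff[OF ord red] by simp
qed

end
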